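(* For every integer $m\ge 2$, there exist univariate polynomials $p_1,\dots,p_m$ with real coefficients, each of degree at most $2m-3$, satisfying: 1. $p_i(t)\ge 0$ for all $t\in[-1,1]$ and all $i=1,\dots,m$; 2. $\sum_{i=1}^m p_i(t)=1$ for all $t\in[-1,1]$; and 3. for every $i=1,\dots,m$ there exists $t_i\in[-1,1]$ such that $p_i(t_i)=1$. *)

theory Defs
  imports Complex_Main "HOL-Computational_Algebra.Polynomial"
begin

end

theory Submission
  imports Defs
begin

text \<open>
  The polynomials come from the Fejer kernel
  \<open>F x = \<bar>\<Sum>j<M. exp (\<i> j x)\<bar>\<^sup>2 / M\<^sup>2\<close> with \<open>M = 2 * (m - 1)\<close>.  It is a nonnegative
  trigonometric polynomial of degree \<open>M - 1 = 2 * m - 3\<close>, it takes the value 1 at 0, and its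
  translates by the \<open>M\<close> equispaced angles \<open>\<theta>\<^sub>r = 2 * pi * r / M\<close> add up to 1: summing over
  these angles kills every frequency strictly between 0 and \<open>M\<close>, and the constant term of \<open>F\<close>
  is \<open>1 / M\<close>.

  In general a translate of \<open>F\<close> is not even in \<open>x\<close>, hence no polynomial in \<open>cos x\<close>.  But
  the mean of the translates by \<open>\<theta>\<^sub>r\<close> and \<open>-\<theta>\<^sub>r\<close> is even, and \<open>fejer_poly M r\<close> is the algebraic
  polynomial that it defines through \<open>t = cos x\<close>.  The indices \<open>r\<close> and \<open>M - r\<close> give the same
  polynomial.  Grouping them leaves one polynomial for each of the \<open>m\<close> distinct points
  \<open>cos \<theta>\<^sub>k\<close>, \<open>k = 0, \<dots>, m - 1\<close>.

  Nonnegativity and the sum 1 pass to the groups.  At \<open>cos \<theta>\<^sub>k\<close> the translates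
  that are evaluated at a multiple of \<open>2 * pi\<close> make the value of the \<open>k\<close>-th group at least
  \<open>F 0 = 1\<close> (lemma \<open>fejer_group_at_node\<close>).  Since the groups are nonnegative with sum 1, no value
  exceeds 1, so this one is exactly 1.
\<close>

section \<open>Chebyshev polynomials\<close>

fun chebyshev :: "nat \<Rightarrow> real poly" where
  "chebyshev 0 = 1"
| "chebyshev (Suc 0) = [:0, 1:]"
| "chebyshev (Suc (Suc n)) = [:0, 2:] * chebyshev (Suc n) - chebyshev n"

lemma degree_chebyshev_le: "degree (chebyshev n) \<le> n"
proof (induction n rule: chebyshev.induct)
  case (3 n)
  have "degree ([:0, 2:] * chebyshev (Suc n)) \<le> degree [:0, 2::real:] + degree (chebyshev (Suc n))"
    by (rule degree_mult_le)
  also have "\<dots> \<le> Suc (Suc n)"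
    using 3 by simp
  finally show ?case
    using 3 by (auto intro: degree_diff_le)
qed auto

lemma poly_chebyshev_cos: "poly (chebyshev n) (cos x) = cos (real n * x)"
proof (induction n rule: chebyshev.induct)
  case (3 n)
  have "cos (real (Suc (Suc n)) * x) + cos (real n * x) = 2 * cos x * cos (real (Suc n) * x)"
    using cos_add[of "real (Suc n) * x" x] cos_diff[of "real (Suc n) * x" x]
    by (simp add: algebra_simps)
  with 3 show ?case
    by (simp add: algebra_simps)
qed auto

section \<open>The Fejer kernel\<close>

definition fejer :: "nat \<Rightarrow> real \<Rightarrow> real" where
  "fejer M x = (\<Sum>i<M. \<Sum>j<M. cos (real i * x - real j * x)) / (real M)\<^sup>2"

text \<open>The double sum is the squared modulus of \<open>\<Sum>j<M. cis (j * x)\<close>.\<close>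

lemma fejer_nonneg: "fejer M x \<ge> 0"
proof -
  have "(\<Sum>i<M. \<Sum>j<M. cos (real i * x - real j * x)) =
      (\<Sum>i<M. cos (real i * x))\<^sup>2 + (\<Sum>i<M. sin (real i * x))\<^sup>2"
    by (simp add: cos_diff sum.distrib power2_eq_square sum_product)
  then show ?thesis
    unfolding fejer_def by simp
qed

lemma fejer_eq_1:
  assumes "M > 0" and "\<And>n :: nat. cos (real n * x) = 1"
  shows "fejer M x = 1"
proof -
  have "sin (real n * x) = 0" for n
    using sin_cos_squared_add[of "real n * x"] assms(2)[of n] by simp
  then have "cos (real i * x - real j * x) = 1" for i j
    using assms(2) by (simp add: cos_diff)
  then show ?thesis
    using assms(1) by (simp add: fejer_def power2_eq_square)
qed

text \<open>The angles are the arguments of the powers of a nontrivial \<open>M\<close>-th root of unity.\<close>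

lemma sum_cos_equispaced:
  assumes "0 < n" "n < M"
  shows "(\<Sum>r<M. cos (real n * (2 * pi * real r / real M))) = 0"
proof -
  define z where "z = cis (2 * pi * real n / real M)"
  have M: "M > 0"
    using assms by simp
  have "z \<noteq> 1"
  proof
    assume "z = 1"
    then have "cos (2 * pi * real n / real M) = 1"
      by (simp add: z_def complex_eq_iff)
    then obtain k :: int where "2 * pi * real n / real M = of_int k * 2 * pi"
      using cos_one_2pi_int by blast
    then have "real n = real_of_int k * real M"
      using M by (simp add: field_simps)
    then have "int n = k * int M"
      by (metis of_int_eq_iff of_int_mult of_int_of_nat_eq)
    then have "int M dvd int n"
      by simp
    with assms show False
      using zdvd_imp_le by fastforce
  qed
  moreover have "z ^ M = 1"
    using M cis_multiple_2pi[of "real n"] by (simp add: z_def DeMoivre)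
  ultimately have "(\<Sum>r<M. z ^ r) = 0"
    by (simp add: sum_gp_strict)
  then have "Re (\<Sum>r<M. z ^ r) = 0"
    by simp
  then show ?thesis
    by (simp add: z_def DeMoivre algebra_simps)
qed

section \<open>Symmetrized translates as polynomials\<close>

definition fejer_node :: "nat \<Rightarrow> nat \<Rightarrow> real" where
  "fejer_node M r = 2 * pi * real r / real M"

definition fejer_poly :: "nat \<Rightarrow> nat \<Rightarrow> real poly" where
  "fejer_poly M r = smult (1 / (real M)\<^sup>2) (\<Sum>i<M. \<Sum>j<M.
     smult (cos (real (nat \<bar>int i - int j\<bar>) * fejer_node M r)) (chebyshev (nat \<bar>int i - int j\<bar>)))"

lemma cos_abs_diff:
  "cos (\<bar>real i - real j\<bar> * x) = cos (real i * x - real j * x)"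
  using cos_minus[of "real i * x - real j * x"] by (simp add: abs_if algebra_simps)

lemma degree_fejer_poly_le: "degree (fejer_poly M r) \<le> M - 1"
  unfolding fejer_poly_def
proof (intro order.trans[OF degree_smult_le] degree_sum_le)
  fix i j
  assume "i \<in> {..<M}" "j \<in> {..<M}"
  then have "nat \<bar>int i - int j\<bar> \<le> M - 1"
    by auto
  then show "degree (chebyshev (nat \<bar>int i - int j\<bar>)) \<le> M - 1"
    using degree_chebyshev_le order.trans by blast
qed auto

lemma poly_fejer_poly_cos:
  "poly (fejer_poly M r) (cos x) = (fejer M (x - fejer_node M r) + fejer M (x + fejer_node M r)) / 2"
proof -
  let ?y = "fejer_node M r"
  have "cos (real i * ?y - real j * ?y) * cos (real i * x - real j * x) =
      (cos (real i * (x - ?y) - real j * (x - ?y)) + cos (real i * (x + ?y) - real j * (x + ?y))) / 2"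
    for i j
    using cos_add[of "real i * x - real j * x" "real i * ?y - real j * ?y"]
      cos_diff[of "real i * x - real j * x" "real i * ?y - real j * ?y"]
    by (simp add: algebra_simps)
  then show ?thesis
    by (simp add: fejer_poly_def fejer_def poly_sum poly_chebyshev_cos cos_abs_diff
        sum.distrib add_divide_distrib flip: sum_divide_distrib)
qed

lemma poly_fejer_poly_nonneg:
  assumes "t \<in> {-1..1}"
  shows "poly (fejer_poly M r) t \<ge> 0"
proof -
  have "poly (fejer_poly M r) (cos (arccos t)) \<ge> 0"
    by (simp add: poly_fejer_poly_cos fejer_nonneg)
  then show ?thesis
    using assms by simp
qed

text \<open>Summed over \<open>r\<close>, the coefficient of each pair \<open>i \<noteq> j\<close> vanishes, and the \<open>M\<close> diagonal pairs
  contribute \<open>M\<close> each.\<close>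

lemma sum_fejer_poly:
  assumes "M > 0"
  shows "(\<Sum>r<M. fejer_poly M r) = 1"
proof -
  let ?d = "\<lambda>i j. nat \<bar>int i - int j\<bar>"
  have coeff: "(\<Sum>r<M. cos (\<bar>real i - real j\<bar> * fejer_node M r)) = (if i = j then real M else 0)"
    if "i < M" "j < M" for i j
    using that sum_cos_equispaced[of "?d i j" M] by (auto simp: fejer_node_def)
  have "(\<Sum>r<M. fejer_poly M r) = smult (1 / (real M)\<^sup>2) (\<Sum>r<M. \<Sum>i<M. \<Sum>j<M.
      smult (cos (real (?d i j) * fejer_node M r)) (chebyshev (?d i j)))"
    by (intro poly_eqI) (simp add: fejer_poly_def coeff_sum sum_distrib_left)
  also have "(\<Sum>r<M. \<Sum>i<M. \<Sum>j<M.
        smult (cos (real (?d i j) * fejer_node M r)) (chebyshev (?d i j))) =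
      (\<Sum>i<M. \<Sum>r<M. \<Sum>j<M.
        smult (cos (real (?d i j) * fejer_node M r)) (chebyshev (?d i j)))"
    by (rule sum.swap)
  also have "\<dots> = (\<Sum>i<M. \<Sum>j<M. \<Sum>r<M.
        smult (cos (real (?d i j) * fejer_node M r)) (chebyshev (?d i j)))"
    by (intro sum.cong refl sum.swap)
  also have "\<dots> = (\<Sum>i<M. \<Sum>j<M. smult (if i = j then real M else 0) (chebyshev (?d i j)))"
    by (intro sum.cong refl) (simp add: coeff flip: smult_sum)
  also have "\<dots> = (\<Sum>i<M. \<Sum>j<M. if j = i then smult (real M) 1 else 0)"
    by (intro sum.cong refl) auto
  also have "\<dots> = smult ((real M)\<^sup>2) 1"
    by (simp add: power2_eq_square of_nat_poly)
  finally show ?thesis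
    using assms by simp
qed

section \<open>Grouping equal polynomials\<close>

text \<open>For \<open>k \<le> N\<close> the group consists of the indices \<open>r < 2 * N\<close> with
  \<open>cos (fejer_node (2 * N) r) = cos (fejer_node (2 * N) k)\<close>: the pair \<open>k, 2 * N - k\<close>, or \<open>k\<close> alone if
  \<open>k\<close> is 0 or \<open>N\<close>.\<close>

definition fejer_group :: "nat \<Rightarrow> nat \<Rightarrow> real poly" where
  "fejer_group N k = (\<Sum>r | r \<in> {..<2 * N} \<and> min r (2 * N - r) = k. fejer_poly (2 * N) r)"

lemma degree_fejer_group_le: "degree (fejer_group N k) \<le> 2 * N - 1"
  unfolding fejer_group_def by (intro degree_sum_le degree_fejer_poly_le) auto

lemma poly_fejer_group_nonneg: "t \<in> {-1..1} \<Longrightarrow> poly (fejer_group N k) t \<ge> 0"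
  unfolding fejer_group_def poly_sum by (intro sum_nonneg poly_fejer_poly_nonneg)

lemma sum_fejer_group:
  assumes "N > 0"
  shows "(\<Sum>k\<le>N. fejer_group N k) = 1"
proof -
  have "(\<Sum>k\<le>N. fejer_group N k) = (\<Sum>r<2 * N. fejer_poly (2 * N) r)"
    unfolding fejer_group_def by (rule sum.group) auto
  then show ?thesis
    using assms by (simp add: sum_fejer_poly)
qed

text \<open>For \<open>0 < k < N\<close> each of the two members of the group contributes \<open>F 0 / 2\<close> plus
  a nonnegative term.  For
  \<open>k = 0\<close> and \<open>k = N\<close> the translates by \<open>\<theta>\<^sub>k\<close> and \<open>-\<theta>\<^sub>k\<close> coincide modulo \<open>2 * pi\<close>, so the single
  member contributes \<open>F 0\<close>.\<close>

lemma fejer_group_at_node: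
  assumes "N > 0" "k \<le> N"
  shows "poly (fejer_group N k) (cos (fejer_node (2 * N) k)) \<ge> 1"
proof -
  let ?M = "2 * N"
  let ?x = "fejer_node ?M k"
  have F: "fejer ?M 0 = 1" "fejer ?M (2 * pi) = 1"
    using assms(1) cos_int_2pin[of "int n" for n] by (auto intro!: fejer_eq_1 simp: mult_ac)
  consider "k = 0" | "k = N" | "0 < k" "k < N"
    using assms(2) by linarith
  then show ?thesis
  proof cases
    case 1
    have "{r. r \<in> {..<?M} \<and> min r (?M - r) = k} = {0}"
      using 1 assms(1) by (auto simp: min_def split: if_splits)
    moreover have "?x = 0"
      using 1 by (simp add: fejer_node_def)
    ultimately show ?thesis
      using F 1 poly_fejer_poly_cos[of ?M 0 0] by (simp add: fejer_group_def)
  next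
    case 2
    have "{r. r \<in> {..<?M} \<and> min r (?M - r) = k} = {N}"
      using 2 assms(1) by (auto simp: min_def split: if_splits)
    moreover have "?x = pi"
      using 2 assms(1) by (simp add: fejer_node_def)
    ultimately show ?thesis
      using F 2 poly_fejer_poly_cos[of ?M N pi] by (simp add: fejer_group_def)
  next
    case 3
    have "{r. r \<in> {..<?M} \<and> min r (?M - r) = k} = {k, ?M - k}"
      using 3 by (auto simp: min_def split: if_splits)
    moreover have "k \<noteq> ?M - k"
      using 3 by simp
    ultimately have "poly (fejer_group N k) (cos ?x) =
        poly (fejer_poly ?M k) (cos ?x) + poly (fejer_poly ?M (?M - k)) (cos ?x)"
      by (simp add: fejer_group_def)
    moreover have "poly (fejer_poly ?M k) (cos ?x) \<ge> 1 / 2"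
      using F fejer_nonneg[of ?M "?x + ?x"] by (simp add: poly_fejer_poly_cos)
    moreover have "?x + fejer_node ?M (?M - k) = 2 * pi"
      using 3 by (simp add: fejer_node_def of_nat_diff field_simps)
    then have "poly (fejer_poly ?M (?M - k)) (cos ?x) \<ge> 1 / 2"
      using F fejer_nonneg[of ?M "?x - fejer_node ?M (?M - k)"] by (simp add: poly_fejer_poly_cos)
    ultimately show ?thesis
      by linarith
  qed
qed

theorem lemma5p2:
  fixes m :: nat
  assumes "m \<ge> 2"
  shows "\<exists>p :: nat \<Rightarrow> real poly.
           (\<forall>i\<in>{1..m}. degree (p i) \<le> 2 * m - 3) \<and>
           (\<forall>i\<in>{1..m}. \<forall>t\<in>{-1..1}. poly (p i) t \<ge> 0) \<and>
           (\<forall>t\<in>{-1..1}. (\<Sum>i=1..m. poly (p i) t) = 1) \<and>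
           (\<forall>i\<in>{1..m}. \<exists>t\<in>{-1..1}. poly (p i) t = 1)"
proof -
  define N where "N = m - 1"
  define p where "p = (\<lambda>i. fejer_group N (i - 1))"
  have N: "N > 0"
    using assms by (simp add: N_def)
  have deg: "degree (p i) \<le> 2 * m - 3" for i
    using degree_fejer_group_le[of N "i - 1"] by (simp add: p_def N_def)
  have nonneg: "poly (p i) t \<ge> 0" if "t \<in> {-1..1}" for i t
    using that by (simp add: p_def poly_fejer_group_nonneg)
  have "(\<Sum>i=1..m. p i) = (\<Sum>k\<le>N. fejer_group N k)"
    using assms by (intro sum.reindex_bij_witness[of _ Suc "\<lambda>i. i - 1"]) (auto simp: p_def N_def)
  then have "(\<Sum>i=1..m. p i) = 1"
    using N by (simp add: sum_fejer_group)
  then have sum: "(\<Sum>i=1..m. poly (p i) t) = 1" for t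
    by (metis poly_1 poly_sum)
  have "poly (p i) (cos (fejer_node (2 * N) (i - 1))) = 1" if "i \<in> {1..m}" for i
  proof (rule antisym)
    let ?t = "cos (fejer_node (2 * N) (i - 1))"
    have "poly (p i) ?t \<le> (\<Sum>i=1..m. poly (p i) ?t)"
      using that nonneg by (intro member_le_sum) auto
    then show "poly (p i) ?t \<le> 1"
      unfolding sum .
    show "1 \<le> poly (p i) ?t"
      using that N unfolding p_def by (intro fejer_group_at_node) (auto simp: N_def)
  qed
  then have "\<exists>t\<in>{-1..1}. poly (p i) t = 1" if "i \<in> {1..m}" for i
    using that by (intro bexI[of _ "cos (fejer_node (2 * N) (i - 1))"]) auto
  with deg nonneg sum show ?thesis
    by blast
qed

end
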